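(* Assume the standing setup, fix $\omega\in\Omega$ and $(\hat x_0,\hat y_0)\in\mathbb{R}^n\times\mathbb{R}^m$, and let $\eta>0$ with $b<\eta<a$ satisfy $\rho:=\frac{K}{a-\eta}+\frac{K}{\eta-b}<1$. Then for every $u_0\in\mathbb{R}^n$ the integral system $$u(t)=e^{At+\int_0^t z(\theta_\tau\omega)d\tau}u_0+\int_0^t e^{A(t-s)+\int_s^t z(\theta_\tau\omega)d\tau}\Delta F(u(s),v(s),\theta_s\omega)\,ds,\quad v(t)=\int_{-\infty}^t e^{B(t-s)+\int_s^t z(\theta_\tau\omega)d\tau}\Delta G(u(s),v(s),\theta_s\omega)\,ds,\quad t\le 0,$$ has a unique solution $\phi(\cdot)=\phi(\cdot,\omega,(\hat x_0,\hat y_0);u_0)=(u,v)$ in $C^-_\eta$.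
   Context: Standing setup: $1<\alpha<2$; $\Omega$ is a $\{\theta_t\}$-invariant full-measure set of càdlàg paths $\omega:\mathbb{R}\to\mathbb{R}$ ($\omega(0)=0$) of a two-sided scalar symmetric $\alpha$-stable Lévy motion, with $\theta_t\omega=\omega(\cdot+t)-\omega(t)$, on which $z(\omega)=-\int_{-\infty}^0e^\tau\omega(\tau)d\tau$ exists, $t\mapsto z(\theta_t\omega)$ is càdlàg, $\lim_{t\to\pm\infty}|z(\theta_t\omega)|/|t|=0$ and $\lim_{t\to\pm\infty}\frac1t\int_0^tz(\theta_\tau\omega)d\tau=0$. (A1) $A$ is a real $n\times n$ matrix and $B$ a real $m\times m$ matrix with $|e^{At}x|\le e^{at}|x|$ for $t\le0$ and $|e^{Bt}y|\le e^{bt}|y|$ for $t\ge 0$, where $b<0<a$. (A2) $f:\mathbb{R}^n\times\mathbb{R}^m\to\mathbb{R}^n$, $g:\mathbb{R}^n\times\mathbb{R}^m\to\mathbb{R}^m$ satisfy $f(0,0)=0$, $g(0,0)=0$, $|f(x_1,y_1)-f(x_2,y_2)|\le K(|x_1-x_2|+|y_1-y_2|)$ and the same for $g$. Put $F(x,y,\omega)=e^{-z(\omega)}f(e^{z(\omega)}x,e^{z(\omega)}y)$, $G(x,y,\omega)=e^{-z(\omega)}g(e^{z(\omega)}x,e^{z(\omega)}y)$. The random system (RDE) is $\frac{d\hat x}{dt}=A\hat x+F(\hat x,\hat y,\theta_t\omega)+z(\theta_t\omega)\hat x$, $\frac{d\hat y}{dt}=B\hat y+G(\hat x,\hat y,\theta_t\omega)+z(\theta_t\omega)\hat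 y$; $\varphi(t,\omega,(\hat x_0,\hat y_0))=(\hat x(t),\hat y(t))$ denotes its (Carathéodory) solution, defined for all $t\in\mathbb{R}$, with $(\hat x(0),\hat y(0))=(\hat x_0,\hat y_0)$. $|\cdot|$ is the Euclidean norm. For fixed $\omega$ and $\eta\in\mathbb{R}$, $C^-_\eta$ is the Banach space of continuous $\phi=(u,v):(-\infty,0]\to\mathbb{R}^n\times\mathbb{R}^m$ with $\|\phi\|_{C^-_\eta}=\sup_{t\le0}e^{-\eta t-\int_0^tz(\theta_\tau\omega)d\tau}|u(t)|+\sup_{t\le0}e^{-\eta t-\int_0^tz(\theta_\tau\omega)d\tau}|v(t)|<\infty$. Given a base point $(\hat x_0,\hat y_0)$ with orbit $(\hat x(t),\hat y(t))=\varphi(t,\omega,(\hat x_0,\hat y_0))$, define $\Delta F(u,v,\theta_t\omega)=F(u+\hat x(t),v+\hat y(t),\theta_t\omega)-F(\hat x(t),\hat y(t),\theta_t\omega)$ and $\Delta G$ analogously with $G$. *)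

theory Defs
  imports "HOL-Analysis.Analysis"
begin

text \<open>Powers and exponential of a real square matrix (real^'n^'n).\<close>
primrec matpow :: "real^'n^'n \<Rightarrow> nat \<Rightarrow> real^'n^'n" where
  "matpow M 0 = mat 1"
| "matpow M (Suc k) = M ** matpow M k"

definition mexp :: "real^'n^'n \<Rightarrow> real^'n^'n" where
  "mexp M = (\<Sum>k. (1 / (fact k :: real)) *\<^sub>R matpow M k)"

text \<open>Oriented integral over [a,b]: for b < a it is minus the integral over [b,a].\<close>
definition oint :: "real \<Rightarrow> real \<Rightarrow> (real \<Rightarrow> 'a::euclidean_space) \<Rightarrow> 'a" where
  "oint a b g = (if a \<le> b then integral {a..b} g else - integral {b..a} g)"

text \<open>cadlag: right-continuous with left limits everywhere.\<close>
definition cadlag :: "(real \<Rightarrow> real) \<Rightarrow> bool" where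
  "cadlag g \<longleftrightarrow> (\<forall>t. continuous (at_right t) g \<and> (\<exists>l. (g \<longlongrightarrow> l) (at_left t)))"

text \<open>Wiener shift on paths and the stationary variable z.\<close>
definition theta :: "real \<Rightarrow> (real \<Rightarrow> real) \<Rightarrow> (real \<Rightarrow> real)" where
  "theta t w = (\<lambda>s. w (s + t) - w t)"

definition zv :: "(real \<Rightarrow> real) \<Rightarrow> real" where
  "zv w = - integral {..0} (\<lambda>\<tau>. exp \<tau> * w \<tau>)"

text \<open>Standing assumptions on a path w belonging to Omega (properties used for fixed w).\<close>
definition in_Omega :: "(real \<Rightarrow> real) \<Rightarrow> bool" where
  "in_Omega w \<longleftrightarrow>
     w 0 = 0 \<and> cadlag w \<and>
     (\<forall>t. (\<lambda>\<tau>. exp \<tau> * theta t w \<tau>) integrable_on {..0}) \<and>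
     cadlag (\<lambda>t. zv (theta t w)) \<and>
     ((\<lambda>t. \<bar>zv (theta t w)\<bar> / \<bar>t\<bar>) \<longlongrightarrow> 0) at_top \<and>
     ((\<lambda>t. \<bar>zv (theta t w)\<bar> / \<bar>t\<bar>) \<longlongrightarrow> 0) at_bot \<and>
     ((\<lambda>t. oint 0 t (\<lambda>\<tau>. zv (theta \<tau> w)) / t) \<longlongrightarrow> 0) at_top \<and>
     ((\<lambda>t. oint 0 t (\<lambda>\<tau>. zv (theta \<tau> w)) / t) \<longlongrightarrow> 0) at_bot"

text \<open>Transformed nonlinearities F, G.\<close>
definition Ftr :: "('x::real_normed_vector \<Rightarrow> 'y::real_normed_vector \<Rightarrow> 'r::real_normed_vector)
    \<Rightarrow> 'x \<Rightarrow> 'y \<Rightarrow> (real \<Rightarrow> real) \<Rightarrow> 'r" where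
  "Ftr f x y w = exp (- zv w) *\<^sub>R f (exp (zv w) *\<^sub>R x) (exp (zv w) *\<^sub>R y)"

text \<open>Z w t = integral from 0 to t of z(theta_tau w).\<close>
definition Zint :: "(real \<Rightarrow> real) \<Rightarrow> real \<Rightarrow> real" where
  "Zint w t = oint 0 t (\<lambda>\<tau>. zv (theta \<tau> w))"

text \<open>(xh, yh) is a (Caratheodory, integral-form) solution of the RDE on all of R.\<close>
definition rde_solution ::
  "real^'n^'n \<Rightarrow> real^'m^'m \<Rightarrow> (real^'n \<Rightarrow> real^'m \<Rightarrow> real^'n) \<Rightarrow> (real^'n \<Rightarrow> real^'m \<Rightarrow> real^'m)
   \<Rightarrow> (real \<Rightarrow> real) \<Rightarrow> (real \<Rightarrow> real^'n) \<Rightarrow> (real \<Rightarrow> real^'m) \<Rightarrow> bool" where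
  "rde_solution A B f g w xh yh \<longleftrightarrow>
     continuous_on UNIV xh \<and> continuous_on UNIV yh \<and>
     (\<forall>s t. s \<le> t \<longrightarrow>
        ((\<lambda>\<tau>. A *v xh \<tau> + Ftr f (xh \<tau>) (yh \<tau>) (theta \<tau> w) + zv (theta \<tau> w) *\<^sub>R xh \<tau>)
           has_integral (xh t - xh s)) {s..t} \<and>
        ((\<lambda>\<tau>. B *v yh \<tau> + Ftr g (xh \<tau>) (yh \<tau>) (theta \<tau> w) + zv (theta \<tau> w) *\<^sub>R yh \<tau>)
           has_integral (yh t - yh s)) {s..t})"

text \<open>Membership in C^-_eta (continuity on (-inf,0] and finiteness of the weighted sup norm).\<close>
definition in_Cminus :: "real \<Rightarrow> (real \<Rightarrow> real) \<Rightarrow> (real \<Rightarrow> real^'n) \<Rightarrow> (real \<Rightarrow> real^'m) \<Rightarrow> bool" where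
  "in_Cminus \<eta> w u v \<longleftrightarrow>
     continuous_on {..0} u \<and> continuous_on {..0} v \<and>
     bdd_above ((\<lambda>t. exp (- \<eta> * t - Zint w t) * norm (u t)) ` {..0}) \<and>
     bdd_above ((\<lambda>t. exp (- \<eta> * t - Zint w t) * norm (v t)) ` {..0})"

text \<open>The integral system of Lemma 4.2 on t \<le> 0 (with Delta F, Delta G along the base orbit).\<close>
definition solves_lemma_system ::
  "real^'n^'n \<Rightarrow> real^'m^'m \<Rightarrow> (real^'n \<Rightarrow> real^'m \<Rightarrow> real^'n) \<Rightarrow> (real^'n \<Rightarrow> real^'m \<Rightarrow> real^'m)
   \<Rightarrow> (real \<Rightarrow> real) \<Rightarrow> (real \<Rightarrow> real^'n) \<Rightarrow> (real \<Rightarrow> real^'m) \<Rightarrow> real^'n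
   \<Rightarrow> (real \<Rightarrow> real^'n) \<Rightarrow> (real \<Rightarrow> real^'m) \<Rightarrow> bool" where
  "solves_lemma_system A B f g w xh yh u0 u v \<longleftrightarrow>
     (let dF = (\<lambda>s. Ftr f (u s + xh s) (v s + yh s) (theta s w) - Ftr f (xh s) (yh s) (theta s w));
          dG = (\<lambda>s. Ftr g (u s + xh s) (v s + yh s) (theta s w) - Ftr g (xh s) (yh s) (theta s w))
      in \<forall>t\<le>0.
        ((\<lambda>s. exp (Zint w t - Zint w s) *\<^sub>R (mexp ((t - s) *\<^sub>R A) *v dF s))
            has_integral (exp (Zint w t) *\<^sub>R (mexp (t *\<^sub>R A) *v u0) - u t)) {t..0} \<and>
        ((\<lambda>s. exp (Zint w t - Zint w s) *\<^sub>R (mexp ((t - s) *\<^sub>R B) *v dG s))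
            has_integral v t) {..t})"

end

theory Submission
  imports Defs
begin

text \<open>Write Z(t) for the integral of z(theta_tau w) from 0 to t. Pulling the factor exp(Z t)
  out of both integrals, the right-hand sides of the system define an operator T = (TU, TV) on
  C^-_eta whose weight exp(-eta t - Z t) cancels the random factors exactly. The exponential
  dichotomy and the Lipschitz bound K then make T a contraction with constant
  rho = K/(a - eta) + K/(eta - b) < 1 for the (equivalent) weighted norm
  sup_{t <= 0} exp(-eta t - Z t) (|u t| + |v t|). Existence follows from the convergence of the
  Picard iterates from 0 in this norm, and uniqueness from the contraction property, because the
  solutions in C^-_eta are exactly the fixed points of T. The only irregular ingredient,
  z(theta_s w), is cadlag in s, hence bounded and measurable on compact intervals, which is all the
  integrals need.\<close>

lemma matpow_scaleR: "matpow (t *\<^sub>R M) k = (t ^ k) *\<^sub>R matpow M k"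
  by (induction k) (auto simp: matrix_scalar_ac scalar_matrix_assoc[symmetric])

lemma matpow_add: "matpow M p ** matpow M q = matpow M (p + q)"
  by (induction p) (auto simp: matrix_mul_assoc[symmetric])

lemma onorm_matpow_le: "onorm ((*v) (matpow (M::real^'n^'n) k)) \<le> onorm ((*v) M) ^ k"
proof (induction k)
  case 0
  have "(*v) (mat 1 :: real^'n^'n) = (\<lambda>x. x)" by (auto simp: matrix_vector_mul_lid)
  then show ?case using onorm_id_le by simp
next
  case (Suc k)
  have "(*v) (M ** matpow M k) = (*v) M \<circ> (*v) (matpow M k)"
    by (auto simp: matrix_vector_mul_assoc)
  then have "onorm ((*v) (M ** matpow M k)) \<le> onorm ((*v) M) * onorm ((*v) (matpow M k))"
    by (metis onorm_compose matrix_vector_mul_bounded_linear)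
  also have "\<dots> \<le> onorm ((*v) M) * onorm ((*v) M) ^ k"
    by (rule mult_left_mono[OF Suc]) (auto intro: onorm_pos_le)
  finally show ?case by simp
qed

lemma norm_le_sum_abs_entries: "norm (X::real^'n^'m) \<le> (\<Sum>i\<in>UNIV. \<Sum>j\<in>UNIV. \<bar>X$i$j\<bar>)"
proof -
  have "norm X \<le> (\<Sum>i\<in>UNIV. norm (X$i))"
    unfolding norm_vec_def by (rule L2_set_le_sum) auto
  also have "\<dots> \<le> (\<Sum>i\<in>UNIV. \<Sum>j\<in>UNIV. \<bar>X$i$j\<bar>)"
    by (rule sum_mono) (simp add: norm_le_l1_cart)
  finally show ?thesis .
qed

lemma norm_matpow_le:
  "norm (matpow (M::real^'n^'n) k) \<le> real CARD('n) * real CARD('n) * onorm ((*v) M) ^ k"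
proof -
  have "norm (matpow M k) \<le> (\<Sum>i\<in>(UNIV::'n set). \<Sum>j\<in>(UNIV::'n set). onorm ((*v) M) ^ k)"
    by (rule order_trans[OF norm_le_sum_abs_entries])
       (intro sum_mono order_trans[OF matrix_component_le_onorm onorm_matpow_le])
  then show ?thesis by simp
qed

lemma summable_mexp_majorant:
  "summable (\<lambda>k. real CARD('n) * real CARD('n) * ((R * onorm ((*v) (M::real^'n^'n))) ^ k / fact k))"
  using summable_exp_generic[of "R * onorm ((*v) M)"]
  by (intro summable_mult) (simp add: divide_inverse_commute)

lemma norm_mexp_term_le:
  assumes "\<bar>t\<bar> \<le> R"
  shows "norm ((1 / fact k) *\<^sub>R matpow (t *\<^sub>R (M::real^'n^'n)) k) \<le>
     real CARD('n) * real CARD('n) * ((R * onorm ((*v) M)) ^ k / fact k)"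
proof -
  have "norm ((1 / fact k) *\<^sub>R matpow (t *\<^sub>R M) k) = \<bar>t\<bar> ^ k / fact k * norm (matpow M k)"
    by (simp add: matpow_scaleR power_abs)
  also have "\<dots> \<le> R ^ k / fact k * (real CARD('n) * real CARD('n) * onorm ((*v) M) ^ k)"
    using assms by (intro mult_mono divide_right_mono power_mono norm_matpow_le)
                   (auto intro: onorm_pos_le)
  finally show ?thesis by (simp add: power_mult_distrib field_simps)
qed

lemma summable_norm_mexp_terms:
  "summable (\<lambda>k. norm ((1 / fact k) *\<^sub>R matpow (t *\<^sub>R (M::real^'n^'n)) k))"
  by (rule summable_comparison_test'[OF summable_mexp_majorant[of "\<bar>t\<bar>" M]])
     (use norm_mexp_term_le[of t "\<bar>t\<bar>" _ M] in \<open>simp only: real_norm_def abs_norm_cancel\<close>)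

lemma mexp_sums: "(\<lambda>k. (1 / fact k) *\<^sub>R matpow (t *\<^sub>R (M::real^'n^'n)) k) sums mexp (t *\<^sub>R M)"
  unfolding mexp_def by (rule summable_sums[OF summable_norm_cancel[OF summable_norm_mexp_terms]])

lemma mexp_entry: "mexp (t *\<^sub>R (M::real^'n^'n)) $ i $ j = (\<Sum>k. t ^ k / fact k * matpow M k $ i $ j)"
proof -
  have "bounded_linear (\<lambda>X::real^'n^'n. X $ i $ j)"
    by (rule bounded_linear_compose[OF bounded_linear_vec_nth bounded_linear_vec_nth])
  from bounded_linear.sums[OF this mexp_sums]
  show ?thesis by (simp add: matpow_scaleR sums_iff)
qed

lemma summable_norm_mexp_entry_terms:
  "summable (\<lambda>k. norm (t ^ k / fact k * matpow (M::real^'n^'n) k $ i $ j))"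
proof (rule summable_comparison_test'[OF summable_norm_mexp_terms[of t M]])
  fix k
  have "norm (t ^ k / fact k * matpow M k $ i $ j) = norm (((1 / fact k) *\<^sub>R matpow (t *\<^sub>R M) k) $ i $ j)"
    by (simp add: matpow_scaleR)
  also have "\<dots> \<le> norm ((1 / fact k) *\<^sub>R matpow (t *\<^sub>R M) k)"
    by (rule order_trans[OF Finite_Cartesian_Product.norm_nth_le Finite_Cartesian_Product.norm_nth_le])
  finally show "norm (norm (t ^ k / fact k * matpow M k $ i $ j)) \<le> norm ((1 / fact k) *\<^sub>R matpow (t *\<^sub>R M) k)"
    by simp
qed

lemma power_add_divide_fact:
  "(s + t) ^ k / fact k = (\<Sum>p\<le>k. s ^ p / fact p * (t ^ (k - p) / fact (k - p)) :: real)"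
proof -
  have "(s + t) ^ k / fact k = (\<Sum>p\<le>k. of_nat (k choose p) * s ^ p * t ^ (k - p) / fact k)"
    by (simp add: binomial_ring sum_divide_distrib)
  also have "\<dots> = (\<Sum>p\<le>k. s ^ p / fact p * (t ^ (k - p) / fact (k - p)))"
    by (rule sum.cong) (auto simp: binomial_fact field_simps)
  finally show ?thesis .
qed

text \<open>Entrywise Cauchy product of the two exponential series.\<close>
lemma mexp_add: "mexp ((s + t) *\<^sub>R (M::real^'n^'n)) = mexp (s *\<^sub>R M) ** mexp (t *\<^sub>R M)"
proof -
  let ?P = "matpow M"
  have "mexp ((s + t) *\<^sub>R M) $ i $ j = (mexp (s *\<^sub>R M) ** mexp (t *\<^sub>R M)) $ i $ j" for i j
  proof -
    define c where "c l k = (\<Sum>p\<le>k. (s ^ p / fact p * ?P p $ i $ l) *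
        (t ^ (k - p) / fact (k - p) * ?P (k - p) $ l $ j))" for l k
    have product: "mexp (s *\<^sub>R M) $ i $ l * mexp (t *\<^sub>R M) $ l $ j = (\<Sum>k. c l k)" for l
      unfolding mexp_entry c_def
      by (rule Cauchy_product[OF summable_norm_mexp_entry_terms summable_norm_mexp_entry_terms])
    have summable: "summable (c l)" for l
      unfolding c_def
      by (rule summable_Cauchy_product[OF summable_norm_mexp_entry_terms summable_norm_mexp_entry_terms])
    have coeff: "(\<Sum>l\<in>UNIV. c l k) = (s + t) ^ k / fact k * ?P k $ i $ j" for k
    proof -
      have "(\<Sum>l\<in>UNIV. c l k) = (\<Sum>p\<le>k. s ^ p / fact p * (t ^ (k - p) / fact (k - p)) *
          (?P p ** ?P (k - p)) $ i $ j)"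
        unfolding c_def matrix_matrix_mult_def
        by (subst sum.swap) (simp add: sum_distrib_left mult_ac)
      also have "\<dots> = (s + t) ^ k / fact k * ?P k $ i $ j"
        by (simp add: matpow_add power_add_divide_fact sum_distrib_right)
      finally show ?thesis .
    qed
    have "(mexp (s *\<^sub>R M) ** mexp (t *\<^sub>R M)) $ i $ j = (\<Sum>l\<in>UNIV. \<Sum>k. c l k)"
      by (simp add: matrix_matrix_mult_def product)
    also have "\<dots> = (\<Sum>k. \<Sum>l\<in>UNIV. c l k)"
      by (rule suminf_sum[symmetric]) (rule summable)
    also have "\<dots> = mexp ((s + t) *\<^sub>R M) $ i $ j"
      by (simp add: coeff mexp_entry)
    finally show ?thesis by simp
  qed
  then show ?thesis by (simp add: vec_eq_iff)
qed

lemma mexp_diff_mult: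
  "mexp ((t - s) *\<^sub>R M) *v y = mexp (t *\<^sub>R M) *v (mexp ((- s) *\<^sub>R (M::real^'n^'n)) *v y)"
  using mexp_add[of t "- s" M] by (simp add: matrix_vector_mul_assoc)

lemma continuous_on_mexp [continuous_intros]:
  assumes "continuous_on S c"
  shows "continuous_on S (\<lambda>t. mexp (c t *\<^sub>R (M::real^'n^'n)))"
proof -
  have compact: "continuous_on {-R..R} (\<lambda>t. mexp (t *\<^sub>R M))" for R
  proof (rule uniform_limit_theorem)
    show "uniform_limit {-R..R} (\<lambda>n t. \<Sum>k<n. (1 / fact k) *\<^sub>R matpow (t *\<^sub>R M) k)
        (\<lambda>t. mexp (t *\<^sub>R M)) sequentially"
      unfolding mexp_def
      by (rule Weierstrass_m_test[OF norm_mexp_term_le[where R = R] summable_mexp_majorant]) auto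
    show "\<forall>\<^sub>F n in sequentially. continuous_on {-R..R}
        (\<lambda>t. \<Sum>k<n. (1 / fact k) *\<^sub>R matpow (t *\<^sub>R M) k)"
      by (simp add: matpow_scaleR continuous_intros)
  qed simp
  have "isCont (\<lambda>t. mexp (t *\<^sub>R M)) x" for x
  proof -
    have "x \<in> interior {-(\<bar>x\<bar> + 1)..\<bar>x\<bar> + 1}" by auto
    then show ?thesis using continuous_on_interior[OF compact] by blast
  qed
  then have "continuous_on UNIV (\<lambda>t. mexp (t *\<^sub>R M))"
    by (simp add: continuous_at_imp_continuous_on)
  from continuous_on_compose2[OF this assms] show ?thesis by simp
qed

lemma cadlag_locally_bounded:
  assumes "cadlag g"
  obtains d B where "d > 0" "\<And>y. dist y x < d \<Longrightarrow> \<bar>g y\<bar> \<le> B"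
proof -
  from assms have right: "(g \<longlongrightarrow> g x) (at_right x)" and "\<exists>l. (g \<longlongrightarrow> l) (at_left x)"
    unfolding cadlag_def continuous_within by auto
  then obtain l where left: "(g \<longlongrightarrow> l) (at_left x)" by blast
  have "\<forall>\<^sub>F y in at_right x. dist (g y) (g x) < 1" using right by (rule tendstoD) simp
  then obtain d1 where d1: "d1 > x" "\<And>y. y > x \<Longrightarrow> y < d1 \<Longrightarrow> dist (g y) (g x) < 1"
    unfolding eventually_at_right_field by blast
  have "\<forall>\<^sub>F y in at_left x. dist (g y) l < 1" using left by (rule tendstoD) simp
  then obtain d2 where d2: "d2 < x" "\<And>y. y > d2 \<Longrightarrow> y < x \<Longrightarrow> dist (g y) l < 1"
    unfolding eventually_at_left_field by blast
  have "\<bar>g y\<bar> \<le> \<bar>g x\<bar> + \<bar>l\<bar> + 1" if "dist y x < min (d1 - x) (x - d2)" for y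
  proof (cases y x rule: linorder_cases)
    case less
    then have "dist (g y) l < 1" using d2 that by (auto simp: dist_real_def)
    then show ?thesis by (auto simp: dist_real_def)
  next
    case greater
    then have "dist (g y) (g x) < 1" using d1 that by (auto simp: dist_real_def)
    then show ?thesis by (auto simp: dist_real_def)
  qed simp
  moreover have "min (d1 - x) (x - d2) > 0" using d1 d2 by simp
  ultimately show ?thesis using that by blast
qed

lemma cadlag_bounded_on_interval:
  assumes "cadlag g"
  shows "\<exists>B. \<forall>x\<in>{c..d}. \<bar>g x\<bar> \<le> B"
proof -
  have "\<exists>d B. d > 0 \<and> (\<forall>y. dist y x < d \<longrightarrow> \<bar>g y\<bar> \<le> B)" for x
    using cadlag_locally_bounded[OF assms, of x] by metis
  then obtain e Bx where e: "\<And>x. e x > 0" and Bx: "\<And>x y. dist y x < e x \<Longrightarrow> \<bar>g y\<bar> \<le> Bx x"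
    by metis
  have cover: "{c..d} \<subseteq> \<Union> ((\<lambda>x. ball x (e x)) ` {c..d})"
    using e by (auto simp: dist_commute)
  obtain C where C: "C \<subseteq> {c..d}" "finite C" "{c..d} \<subseteq> \<Union> ((\<lambda>x. ball x (e x)) ` C)"
    by (rule compactE_image[of "{c..d}" "{c..d}" "\<lambda>x. ball x (e x)", OF compact_Icc _ cover]) auto
  have "\<bar>g y\<bar> \<le> (\<Sum>x\<in>C. \<bar>Bx x\<bar>)" if y: "y \<in> {c..d}" for y
  proof -
    obtain x where x: "x \<in> C" "dist y x < e x" using C(3) y by (force simp: dist_commute)
    then have "\<bar>g y\<bar> \<le> \<bar>Bx x\<bar>" using Bx by force
    also have "\<dots> \<le> (\<Sum>x\<in>C. \<bar>Bx x\<bar>)"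
      by (rule member_le_sum) (use x C in auto)
    finally show ?thesis .
  qed
  then show ?thesis by blast
qed

text \<open>A cadlag function is the pointwise limit of its samples at the right end points of the
  grids of mesh 1/(n+1).\<close>
lemma cadlag_borel_measurable:
  assumes "cadlag g"
  shows "g \<in> borel_measurable borel"
proof (rule borel_measurable_LIMSEQ_real)
  define s where "s n t = real_of_int (\<lfloor>real (Suc n) * t\<rfloor> + 1) / real (Suc n)" for n t
  show "(\<lambda>t. g (s n t)) \<in> borel_measurable borel" for n
  proof -
    have "(\<lambda>t. \<lfloor>real (Suc n) * t\<rfloor>) \<in> measurable borel (count_space UNIV)"
      by (rule measurable_compose[OF _ measurable_real_floor]) simp
    then show ?thesis unfolding s_def
      by (rule measurable_compose_countable'[where f = "\<lambda>i t. g (real_of_int (i + 1) / real (Suc n))",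
            rotated]) auto
  qed
  fix t :: real
  have above: "t < s n t" and close: "s n t \<le> t + inverse (real (Suc n))" for n
  proof -
    have "real (Suc n) * t < real_of_int (\<lfloor>real (Suc n) * t\<rfloor> + 1)" by linarith
    then show "t < s n t" unfolding s_def by (simp add: field_simps)
    have "real_of_int (\<lfloor>real (Suc n) * t\<rfloor> + 1) \<le> real (Suc n) * t + 1" by linarith
    then have "s n t \<le> (real (Suc n) * t + 1) / real (Suc n)"
      unfolding s_def by (rule divide_right_mono) simp
    then show "s n t \<le> t + inverse (real (Suc n))" by (simp add: field_simps)
  qed
  have "(\<lambda>n. s n t) \<longlonglongrightarrow> t"
    by (rule tendsto_sandwich[OF _ _ tendsto_const LIMSEQ_inverse_real_of_nat_add])
       (use above close in \<open>auto intro: always_eventually less_imp_le\<close>)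
  then have "filterlim (\<lambda>n. s n t) (at_right t) sequentially"
    by (rule tendsto_imp_filterlim_at_right) (use above in \<open>auto intro: always_eventually\<close>)
  moreover have "(g \<longlongrightarrow> g t) (at_right t)"
    using assms unfolding cadlag_def continuous_within by auto
  ultimately show "(\<lambda>n. g (s n t)) \<longlonglongrightarrow> g t"
    by (rule filterlim_compose[rotated])
qed

lemma borel_measurable_imp_lebesgue_on:
  "f \<in> borel_measurable borel \<Longrightarrow> (f::'a::euclidean_space \<Rightarrow> 'b::euclidean_space) \<in> borel_measurable (lebesgue_on S)"
  by (intro measurable_restrict_space1 measurable_completion) simp

lemma cadlag_integrable_on:
  assumes "cadlag g"
  shows "g integrable_on {c..d}"
proof -
  obtain B where B: "\<And>x. x \<in> {c..d} \<Longrightarrow> \<bar>g x\<bar> \<le> B"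
    using cadlag_bounded_on_interval[OF assms] by blast
  show ?thesis
    by (rule measurable_bounded_by_integrable_imp_integrable[where g = "\<lambda>_. B"])
       (auto intro: borel_measurable_imp_lebesgue_on cadlag_borel_measurable[OF assms] B)
qed

lemma continuous_on_atMost_if_intervals:
  assumes "\<And>c. c \<le> d \<Longrightarrow> continuous_on {c..d::real} F"
  shows "continuous_on {..d} F"
  unfolding continuous_on_eq_continuous_within
proof
  fix x :: real assume x: "x \<in> {..d}"
  have "at x within {..d} = at x within {x - 1..d}"
    by (rule at_within_nhd[where S = "{x - 1<..}"]) auto
  moreover have "continuous (at x within {x - 1..d}) F"
    using assms[of "x - 1"] x by (simp add: continuous_on_eq_continuous_within)
  ultimately show "continuous (at x within {..d}) F" by simp
qed

lemma continuous_on_integral_atLeastAtMost_atMost: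
  assumes "\<And>c. c \<le> d \<Longrightarrow> G integrable_on {c..d}"
  shows "continuous_on {..d} (\<lambda>t. integral {t..d} (G::real \<Rightarrow> 'a::banach))"
  by (rule continuous_on_atMost_if_intervals indefinite_integral_continuous_1' assms)+

lemma continuous_on_matrix_vector_mult [continuous_intros]:
  fixes M :: "'a::topological_space \<Rightarrow> real^'n^'m"
  assumes "continuous_on S M" "continuous_on S x"
  shows "continuous_on S (\<lambda>t. M t *v x t)"
  unfolding matrix_vector_mult_def
  by (intro continuous_on_vec_lambda continuous_intros continuous_on_component assms)

lemma norm_matrix_vector_mult_le: "norm ((M::real^'n^'m) *v x) \<le> (\<Sum>i\<in>UNIV. \<Sum>j\<in>UNIV. \<bar>M$i$j\<bar>) * norm x"
  by (rule order_trans[OF onorm[OF matrix_vector_mul_bounded_linear]])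
     (intro mult_right_mono onorm_le_matrix_component_sum norm_ge_zero)

lemma has_integral_exp_atMost:
  fixes c t :: real assumes "c > 0"
  shows "((\<lambda>s. exp (c * s)) has_integral exp (c * t) / c) {..t}"
proof -
  have h: "((\<lambda>x. exp (- c * x)) has_integral exp (- c * (- t)) / c) {- t..}"
    by (rule has_integral_exp_minus_to_infinity[OF assms])
  then have "(\<lambda>x. exp (- c * x)) absolutely_integrable_on {- t..}"
    by (intro nonnegative_absolutely_integrable_1) (auto simp: has_integral_integrable)
  moreover have "(\<lambda>x. exp (- c * (- x))) absolutely_integrable_on {..t} \<and>
      integral {..t} (\<lambda>x. exp (- c * (- x))) = exp (- c * (- t)) / c
    \<longleftrightarrow> (\<lambda>x. exp (- c * x)) absolutely_integrable_on {- t..} \<and>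
      integral {- t..} (\<lambda>x. exp (- c * x)) = exp (- c * (- t)) / c"
    by (rule has_absolute_integral_reflect_real) (auto simp: image_subset_iff)
  ultimately have "(\<lambda>x. exp (- c * (- x))) absolutely_integrable_on {..t}"
    and "integral {..t} (\<lambda>x. exp (- c * (- x))) = exp (- c * (- t)) / c"
    using integral_unique[OF h] by blast+
  then have "((\<lambda>x. exp (- c * (- x))) has_integral exp (- c * (- t)) / c) {..t}"
    using set_lebesgue_integral_eq_integral(1) integrable_integral by metis
  then show ?thesis by simp
qed

lemma has_integral_exp_interval:
  fixes c t :: real assumes "c \<noteq> 0" "t \<le> 0"
  shows "((\<lambda>s. exp (c * s)) has_integral (1 - exp (c * t)) / c) {t..0}"
proof -
  have "((\<lambda>s. exp (c * s)) has_integral (exp (c * 0) / c - exp (c * t) / c)) {t..0}"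
    by (rule fundamental_theorem_of_calculus[OF assms(2)])
       (use assms in \<open>auto intro!: derivative_eq_intros
          simp: has_real_derivative_iff_has_vector_derivative[symmetric]\<close>)
  then show ?thesis by (simp add: diff_divide_distrib)
qed

definition lipschitz2 :: "real \<Rightarrow> ('x::real_normed_vector \<Rightarrow> 'y::real_normed_vector \<Rightarrow> 'z::real_normed_vector) \<Rightarrow> bool"
  where "lipschitz2 K h \<longleftrightarrow> (\<forall>x1 y1 x2 y2. norm (h x1 y1 - h x2 y2) \<le> K * (norm (x1 - x2) + norm (y1 - y2)))"

lemma lipschitz2D: "lipschitz2 K h \<Longrightarrow> norm (h x1 y1 - h x2 y2) \<le> K * (norm (x1 - x2) + norm (y1 - y2))"
  unfolding lipschitz2_def by blast

lemma lipschitz2_nonneg: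
  assumes "lipschitz2 K (h :: 'x::euclidean_space \<Rightarrow> 'y::real_normed_vector \<Rightarrow> 'z::real_normed_vector)"
  shows "0 \<le> K"
proof -
  obtain e :: 'x where "e \<in> Basis" using nonempty_Basis by blast
  then have "norm (h e 0 - h 0 0) \<le> K" using lipschitz2D[OF assms, of e 0 0 0] by simp
  then show ?thesis by (rule order_trans[OF norm_ge_zero])
qed

lemma lipschitz2_Ftr:
  assumes "lipschitz2 K h"
  shows "lipschitz2 K (\<lambda>x y. Ftr h x y w)"
  unfolding lipschitz2_def
proof (intro allI)
  fix x1 y1 x2 y2
  let ?e = "exp (zv w)"
  have "norm (Ftr h x1 y1 w - Ftr h x2 y2 w) =
      exp (- zv w) * norm (h (?e *\<^sub>R x1) (?e *\<^sub>R y1) - h (?e *\<^sub>R x2) (?e *\<^sub>R y2))"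
    by (simp add: Ftr_def flip: scaleR_diff_right)
  also have "\<dots> \<le> exp (- zv w) * (K * (norm (?e *\<^sub>R x1 - ?e *\<^sub>R x2) + norm (?e *\<^sub>R y1 - ?e *\<^sub>R y2)))"
    by (rule mult_left_mono[OF lipschitz2D[OF assms]]) simp
  also have "\<dots> = K * (norm (x1 - x2) + norm (y1 - y2)) * (exp (- zv w) * ?e)"
    by (simp only: scaleR_diff_right[symmetric] norm_scaleR abs_exp_cancel) (simp only: algebra_simps)
  also have "exp (- zv w) * ?e = 1" by (simp add: exp_minus_inverse mult.commute)
  finally show "norm (Ftr h x1 y1 w - Ftr h x2 y2 w) \<le> K * (norm (x1 - x2) + norm (y1 - y2))"
    by simp
qed

lemma continuous_on_lipschitz2:
  assumes "lipschitz2 K h" "continuous_on S p" "continuous_on S q"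
  shows "continuous_on S (\<lambda>t. h (p t) (q t))"
proof -
  have "dist (h (fst z) (snd z)) (h (fst z') (snd z')) \<le> 2 * \<bar>K\<bar> * dist z z'" for z z'
  proof -
    have "dist (h (fst z) (snd z)) (h (fst z') (snd z')) \<le> K * (dist (fst z) (fst z') + dist (snd z) (snd z'))"
      using lipschitz2D[OF assms(1)] by (simp add: dist_norm)
    also have "\<dots> \<le> \<bar>K\<bar> * (dist (fst z) (fst z') + dist (snd z) (snd z'))"
      by (rule mult_right_mono) auto
    also have "\<dots> \<le> \<bar>K\<bar> * (dist z z' + dist z z')"
      by (intro mult_left_mono add_mono dist_fst_le dist_snd_le) auto
    finally show ?thesis by simp
  qed
  then have "(2 * \<bar>K\<bar>)-lipschitz_on UNIV (\<lambda>z. h (fst z) (snd z))"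
    unfolding lipschitz_on_def by simp
  then have "continuous_on UNIV (\<lambda>z. h (fst z) (snd z))"
    by (rule lipschitz_on_continuous_on)
  then have "continuous_on S (\<lambda>t. (\<lambda>z. h (fst z) (snd z)) (p t, q t))"
    by (rule continuous_on_compose2[OF _ continuous_on_Pair[OF assms(2,3)]]) simp
  then show ?thesis by simp
qed

lemma dist_le_geometric_tail:
  fixes x :: "nat \<Rightarrow> 'a::metric_space"
  assumes step: "\<And>k. dist (x (Suc k)) (x k) \<le> C * r ^ k" and r: "0 \<le> r" "r < 1" and "k \<le> m"
  shows "dist (x m) (x k) \<le> C * (r ^ k - r ^ m) / (1 - r)"
  using \<open>k \<le> m\<close>
proof (induction m rule: dec_induct)
  case (step m)
  have "dist (x (Suc m)) (x k) \<le> dist (x (Suc m)) (x m) + dist (x m) (x k)"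
    by (rule dist_triangle)
  also have "\<dots> \<le> C * r ^ m + C * (r ^ k - r ^ m) / (1 - r)"
    using assms(1) step.IH by (rule add_mono)
  also have "\<dots> = C * (r ^ k - r ^ Suc m) / (1 - r)"
    using r by (simp add: field_simps)
  finally show ?case .
qed simp

lemma geometric_uniform_limit:
  fixes G :: "nat \<Rightarrow> 'b::topological_space \<Rightarrow> 'a::banach"
  assumes cont: "\<And>k. continuous_on S (G k)"
    and step: "\<And>k s. s \<in> S \<Longrightarrow> dist (G (Suc k) s) (G k s) \<le> C * r ^ k"
    and r: "0 \<le> r" "r < 1" and C: "0 \<le> C"
  obtains g where "continuous_on S g" "\<And>k s. s \<in> S \<Longrightarrow> dist (g s) (G k s) \<le> C * r ^ k / (1 - r)"
proof -
  have tail: "dist (G m s) (G k s) \<le> C * r ^ k / (1 - r)" if "k \<le> m" "s \<in> S" for k m s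
  proof -
    have "dist (G m s) (G k s) \<le> C * (r ^ k - r ^ m) / (1 - r)"
      using dist_le_geometric_tail[of "\<lambda>k. G k s"] step[OF \<open>s \<in> S\<close>] r \<open>k \<le> m\<close> by blast
    also have "\<dots> \<le> C * r ^ k / (1 - r)"
      using r C by (intro divide_right_mono mult_left_mono) auto
    finally show ?thesis .
  qed
  have vanish: "(\<lambda>k. C * r ^ k / (1 - r)) \<longlonglongrightarrow> 0"
    using tendsto_mult[OF tendsto_const LIMSEQ_power_zero, of r "C / (1 - r)"] r by simp
  have "uniformly_Cauchy_on S G"
  proof (rule uniformly_Cauchy_onI')
    fix e :: real assume "e > 0"
    then obtain M where M: "\<And>k. k \<ge> M \<Longrightarrow> C * r ^ k / (1 - r) < e"
      using order_tendstoD(2)[OF vanish] unfolding eventually_sequentially by blast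
    have "dist (G m s) (G n s) < e" if "s \<in> S" "m \<ge> M" "n > m" for s m n
      using tail[of m n s] M[of m] that by (simp add: dist_commute)
    then show "\<exists>M. \<forall>s\<in>S. \<forall>m\<ge>M. \<forall>n>m. dist (G m s) (G n s) < e" by blast
  qed
  then obtain g where g: "uniform_limit S G g sequentially"
    using Cauchy_uniformly_convergent uniformly_convergent_on_def by blast
  have "continuous_on S g"
    by (rule uniform_limit_theorem[OF _ g]) (simp_all add: cont)
  moreover have "dist (g s) (G k s) \<le> C * r ^ k / (1 - r)" if "s \<in> S" for k s
  proof (rule LIMSEQ_le_const2)
    show "(\<lambda>m. dist (G m s) (G k s)) \<longlonglongrightarrow> dist (g s) (G k s)"
      by (intro tendsto_dist tendsto_uniform_limitI[OF g that] tendsto_const)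
    show "\<exists>N. \<forall>m\<ge>N. dist (G m s) (G k s) \<le> C * r ^ k / (1 - r)"
      using tail that by blast
  qed
  ultimately show ?thesis by (rule that)
qed

lemma le_zero_if_le_geometric:
  fixes x C r :: real
  assumes "\<And>k. x \<le> C * r ^ k" "0 \<le> r" "r < 1"
  shows "x \<le> 0"
proof (rule LIMSEQ_le_const)
  show "(\<lambda>k. C * r ^ k) \<longlonglongrightarrow> 0"
    using tendsto_mult[OF tendsto_const LIMSEQ_power_zero, of r C] assms(2,3) by simp
qed (use assms(1) in auto)

locale integral_system =
  fixes A :: "real^'n^'n" and B :: "real^'m^'m"
    and f :: "real^'n \<Rightarrow> real^'m \<Rightarrow> real^'n" and g :: "real^'n \<Rightarrow> real^'m \<Rightarrow> real^'m"
    and a b K \<eta> :: real and w :: "real \<Rightarrow> real"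
    and xh :: "real \<Rightarrow> real^'n" and yh :: "real \<Rightarrow> real^'m"
  assumes A_dichotomy: "\<And>t x. t \<le> 0 \<Longrightarrow> norm (mexp (t *\<^sub>R A) *v x) \<le> exp (a * t) * norm x"
    and B_dichotomy: "\<And>t y. t \<ge> 0 \<Longrightarrow> norm (mexp (t *\<^sub>R B) *v y) \<le> exp (b * t) * norm y"
    and f_lipschitz: "lipschitz2 K f" and g_lipschitz: "lipschitz2 K g"
    and K_nonneg: "0 \<le> K"
    and cadlag_z: "cadlag (\<lambda>t. zv (theta t w))"
    and xh_cont: "continuous_on UNIV xh" and yh_cont: "continuous_on UNIV yh"
    and eta: "b < \<eta>" "\<eta> < a"
    and contraction: "K / (a - \<eta>) + K / (\<eta> - b) < 1"
begin

definition zpath :: "real \<Rightarrow> real" where "zpath t = zv (theta t w)"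

definition weight :: "real \<Rightarrow> real" where "weight t = exp (- \<eta> * t - Zint w t)"

definition delta ::
    "(real^'n \<Rightarrow> real^'m \<Rightarrow> 'z::real_normed_vector) \<Rightarrow> (real \<Rightarrow> real^'n) \<Rightarrow> (real \<Rightarrow> real^'m) \<Rightarrow> real \<Rightarrow> 'z"
  where "delta h u v s =
  Ftr h (u s + xh s) (v s + yh s) (theta s w) - Ftr h (xh s) (yh s) (theta s w)"

text \<open>The integrand with the factors depending on the upper limit t pulled out, so that the
  right-hand sides of the system are linear images of integrals of a fixed function.\<close>
definition integrand :: "real^'k^'k \<Rightarrow> (real^'n \<Rightarrow> real^'m \<Rightarrow> real^'k) \<Rightarrow>
    (real \<Rightarrow> real^'n) \<Rightarrow> (real \<Rightarrow> real^'m) \<Rightarrow> real \<Rightarrow> real^'k"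
  where "integrand M h u v s = exp (- Zint w s) *\<^sub>R (mexp ((- s) *\<^sub>R M) *v delta h u v s)"

definition TU :: "real^'n \<Rightarrow> (real \<Rightarrow> real^'n) \<Rightarrow> (real \<Rightarrow> real^'m) \<Rightarrow> real \<Rightarrow> real^'n"
  where "TU u0 u v t = exp (Zint w t) *\<^sub>R (mexp (t *\<^sub>R A) *v (u0 - integral {t..0} (integrand A f u v)))"

definition TV :: "(real \<Rightarrow> real^'n) \<Rightarrow> (real \<Rightarrow> real^'m) \<Rightarrow> real \<Rightarrow> real^'m"
  where "TV u v t = exp (Zint w t) *\<^sub>R (mexp (t *\<^sub>R B) *v integral {..t} (integrand B g u v))"

lemma Zint_eq: "t \<le> 0 \<Longrightarrow> Zint w t = - integral {t..0} zpath"
  unfolding Zint_def oint_def zpath_def by (cases "t = 0") auto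

lemma zpath_integrable_on: "zpath integrable_on {c..d}"
  unfolding zpath_def by (rule cadlag_integrable_on[OF cadlag_z])

lemma zpath_borel_measurable: "zpath \<in> borel_measurable borel"
  unfolding zpath_def by (rule cadlag_borel_measurable[OF cadlag_z])

lemma continuous_on_Zint: "continuous_on {..0} (Zint w)"
proof (rule continuous_on_atMost_if_intervals)
  fix c :: real assume "c \<le> 0"
  have "continuous_on {c..0} (\<lambda>t. - integral {t..0} zpath)"
    by (intro continuous_on_minus indefinite_integral_continuous_1' zpath_integrable_on)
  then show "continuous_on {c..0} (Zint w)" by (rule continuous_on_eq) (auto simp: Zint_eq)
qed

lemma weight_pos: "weight t > 0"
  unfolding weight_def by simp

lemma weight_mult_norm_nonneg: "0 \<le> weight s * norm x"
  using weight_pos[of s] by simp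

lemma continuous_on_weight: "continuous_on {..0} weight"
  unfolding weight_def by (intro continuous_intros continuous_on_Zint)

lemma norm_delta_diff_le:
  "lipschitz2 K h \<Longrightarrow> norm (delta h u v s - delta h u' v' s) \<le> K * (norm (u s - u' s) + norm (v s - v' s))"
  using lipschitz2D[OF lipschitz2_Ftr, of K h "u s + xh s" "v s + yh s" "theta s w" "u' s + xh s" "v' s + yh s"]
  by (simp add: delta_def)

lemma delta_zero: "delta h (\<lambda>_. 0) (\<lambda>_. 0) s = 0"
  by (simp add: delta_def)

lemma norm_delta_le: "lipschitz2 K h \<Longrightarrow> norm (delta h u v s) \<le> K * (norm (u s) + norm (v s))"
  using norm_delta_diff_le[of h u v s "\<lambda>_. 0" "\<lambda>_. 0"] by (simp add: delta_zero)

text \<open>The integrand is a continuous function of s and of the merely measurable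
  value zpath s; the values of u and v on s > 0 are irrelevant and replaced by those at 0.\<close>
lemma integrand_measurable:
  fixes M :: "real^'k^'k" and h :: "real^'n \<Rightarrow> real^'m \<Rightarrow> real^'k"
  assumes h: "lipschitz2 K h" and u: "continuous_on {..0} u" and v: "continuous_on {..0} v"
    and S: "S \<subseteq> {..0}"
  shows "integrand M h u v \<in> borel_measurable (lebesgue_on S)"
proof -
  have fst_min: "continuous_on UNIV (\<lambda>p::real \<times> real. P (min (fst p) 0))"
    if "continuous_on {..0} P" for P :: "real \<Rightarrow> 'c::topological_space"
    by (rule continuous_on_compose2[OF that]) (auto intro!: continuous_intros)
  have fst_UNIV: "continuous_on UNIV (\<lambda>p::real \<times> real. P (fst p))"
    if "continuous_on UNIV P" for P :: "real \<Rightarrow> 'c::topological_space"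
    by (rule continuous_on_compose2[OF that]) (auto intro: continuous_intros)
  define Psi where "Psi p = exp (- Zint w (min (fst p) 0)) *\<^sub>R (mexp ((- fst p) *\<^sub>R M) *v
     (exp (- snd p) *\<^sub>R
       (h (exp (snd p) *\<^sub>R (u (min (fst p) 0) + xh (fst p))) (exp (snd p) *\<^sub>R (v (min (fst p) 0) + yh (fst p)))
        - h (exp (snd p) *\<^sub>R xh (fst p)) (exp (snd p) *\<^sub>R yh (fst p)))))" for p :: "real \<times> real"
  have cont: "continuous_on UNIV Psi"
    unfolding Psi_def
    by (intro continuous_intros continuous_on_lipschitz2[OF h] fst_min fst_UNIV continuous_on_Zint u v
          xh_cont yh_cont)
  have meas: "(\<lambda>s. (s, zpath s)) \<in> borel_measurable borel"
    by (rule borel_measurable_Pair[OF _ zpath_borel_measurable]) simp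
  have "(\<lambda>s. Psi (s, zpath s)) \<in> borel_measurable (lebesgue_on S)"
    by (rule borel_measurable_imp_lebesgue_on[OF borel_measurable_continuous_on[OF cont meas]])
  moreover have "Psi (s, zpath s) = integrand M h u v s" if "s \<in> S" for s
  proof -
    have "min s 0 = s" using that S by auto
    then show ?thesis
      unfolding Psi_def integrand_def delta_def Ftr_def zpath_def by (simp add: scaleR_diff_right)
  qed
  ultimately show ?thesis
    by (rule measurable_cong[THEN iffD1, rotated]) simp
qed

lemma integrand_integrable_on_interval:
  fixes M :: "real^'k^'k" and h :: "real^'n \<Rightarrow> real^'m \<Rightarrow> real^'k"
  assumes h: "lipschitz2 K h" and u: "continuous_on {..0} u" and v: "continuous_on {..0} v"
    and t: "t \<le> 0"
  shows "integrand M h u v integrable_on {t..0}"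
proof -
  define G where "G s = exp (- Zint w s) *
    ((\<Sum>i\<in>UNIV. \<Sum>j\<in>UNIV. \<bar>mexp ((- s) *\<^sub>R M) $ i $ j\<bar>) * (K * (norm (u s) + norm (v s))))" for s
  have sub: "{t..0} \<subseteq> {..0}" by auto
  have "continuous_on {t..0} G"
    unfolding G_def
    by (intro continuous_intros continuous_on_component continuous_on_subset[OF continuous_on_Zint sub]
          continuous_on_subset[OF u sub] continuous_on_subset[OF v sub])
  moreover have "norm (integrand M h u v s) \<le> G s" for s
    unfolding integrand_def G_def norm_scaleR abs_exp_cancel
    by (intro mult_left_mono order_trans[OF norm_matrix_vector_mult_le] norm_delta_le[OF h])
       (auto intro!: sum_nonneg)
  ultimately show ?thesis
    by (intro measurable_bounded_by_integrable_imp_integrable[OF integrand_measurable[OF h u v sub]]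
          integrable_continuous_interval) auto
qed

lemma weight_mult_exp: "weight s * exp (\<eta> * s + Zint w s) = 1"
  unfolding weight_def by (simp flip: exp_add)

lemma le_of_weight_mult_le: "weight s * x \<le> C \<Longrightarrow> x \<le> C * exp (\<eta> * s + Zint w s)"
  using mult_right_mono[of "weight s * x" C "exp (\<eta> * s + Zint w s)"]
  by (simp add: mult.commute[of "weight s"] mult.assoc weight_mult_exp)

lemma in_Cminus_iff:
  "in_Cminus \<eta> w u v \<longleftrightarrow> continuous_on {..0} u \<and> continuous_on {..0} v \<and>
     bdd_above ((\<lambda>s. weight s * (norm (u s) + norm (v s))) ` {..0})"
proof -
  have "bdd_above ((\<lambda>s. weight s * norm (u s)) ` {..0}) \<and> bdd_above ((\<lambda>s. weight s * norm (v s)) ` {..0})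
      \<longleftrightarrow> bdd_above ((\<lambda>s. weight s * (norm (u s) + norm (v s))) ` {..0})"
  proof
    assume "bdd_above ((\<lambda>s. weight s * norm (u s)) ` {..0}) \<and> bdd_above ((\<lambda>s. weight s * norm (v s)) ` {..0})"
    then obtain Cu Cv where "\<And>s. s \<le> 0 \<Longrightarrow> weight s * norm (u s) \<le> Cu" "\<And>s. s \<le> 0 \<Longrightarrow> weight s * norm (v s) \<le> Cv"
      unfolding bdd_above_def by auto
    then show "bdd_above ((\<lambda>s. weight s * (norm (u s) + norm (v s))) ` {..0})"
      by (intro bdd_aboveI2[where M = "Cu + Cv"]) (simp add: distrib_left add_mono)
  next
    assume "bdd_above ((\<lambda>s. weight s * (norm (u s) + norm (v s))) ` {..0})"
    then obtain C where C: "\<And>s. s \<le> 0 \<Longrightarrow> weight s * (norm (u s) + norm (v s)) \<le> C"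
      unfolding bdd_above_def by auto
    have "weight s * norm (u s) \<le> C" "weight s * norm (v s) \<le> C" if "s \<le> 0" for s
    proof -
      have "0 \<le> weight s * norm (u s)" "0 \<le> weight s * norm (v s)"
        using weight_pos[of s] by simp_all
      then show "weight s * norm (u s) \<le> C" "weight s * norm (v s) \<le> C"
        using C[OF that] by (simp_all add: distrib_left)
    qed
    then show "bdd_above ((\<lambda>s. weight s * norm (u s)) ` {..0}) \<and> bdd_above ((\<lambda>s. weight s * norm (v s)) ` {..0})"
      by (auto intro!: bdd_aboveI2[where M = C])
  qed
  then show ?thesis unfolding in_Cminus_def weight_def by simp
qed

lemma in_CminusE:
  assumes "in_Cminus \<eta> w u v"
  obtains C where "\<And>s. s \<le> 0 \<Longrightarrow> weight s * (norm (u s) + norm (v s)) \<le> C"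
  using assms unfolding in_Cminus_iff bdd_above_def by auto

lemma integrand_integrable_on_atMost:
  fixes M :: "real^'k^'k" and h :: "real^'n \<Rightarrow> real^'m \<Rightarrow> real^'k"
  assumes h: "lipschitz2 K h" and X: "in_Cminus \<eta> w u v"
    and dichotomy: "\<And>s x. s \<le> 0 \<Longrightarrow> norm (mexp ((- s) *\<^sub>R M) *v x) \<le> exp (c * (- s)) * norm x"
    and "c < \<eta>" and "t \<le> 0"
  shows "integrand M h u v integrable_on {..t}"
proof -
  obtain C where C: "\<And>s. s \<le> 0 \<Longrightarrow> weight s * (norm (u s) + norm (v s)) \<le> C"
    using in_CminusE[OF X] by blast
  have bound: "norm (integrand M h u v s) \<le> K * C * exp ((\<eta> - c) * s)" if "s \<in> {..t}" for s
  proof -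
    have s: "s \<le> 0" using that \<open>t \<le> 0\<close> by simp
    have delta: "norm (delta h u v s) \<le> K * (C * exp (\<eta> * s + Zint w s))"
      using order_trans[OF norm_delta_le[OF h, of u v s] mult_left_mono[OF le_of_weight_mult_le[OF C[OF s]] K_nonneg]] .
    have "norm (integrand M h u v s) = exp (- Zint w s) * norm (mexp ((- s) *\<^sub>R M) *v delta h u v s)"
      by (simp add: integrand_def)
    also have "\<dots> \<le> exp (- Zint w s) * (exp (c * (- s)) * (K * (C * exp (\<eta> * s + Zint w s))))"
      by (intro mult_left_mono order_trans[OF dichotomy[OF s]] delta) auto
    also have "\<dots> = K * C * exp ((\<eta> - c) * s)"
      by (simp add: algebra_simps flip: exp_add)
    finally show ?thesis .
  qed
  have "(\<lambda>s. exp ((\<eta> - c) * s)) integrable_on {..t}"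
    using has_integral_exp_atMost[of "\<eta> - c" t] \<open>c < \<eta>\<close> by (auto intro: has_integral_integrable)
  then have majorant: "(\<lambda>s. K * C * exp ((\<eta> - c) * s)) integrable_on {..t}"
    using integrable_on_cmult_left[of _ _ "K * C"] by (metis of_real_eq_id id_apply)
  have u: "continuous_on {..0} u" and v: "continuous_on {..0} v"
    using X by (simp_all add: in_Cminus_iff)
  show ?thesis
    by (rule measurable_bounded_by_integrable_imp_integrable[OF integrand_measurable[OF h u v] majorant bound])
       (use \<open>t \<le> 0\<close> in auto)
qed

lemma integrand_scaled:
  "exp (Zint w t) *\<^sub>R (mexp (t *\<^sub>R M) *v integrand M h u v s) =
    exp (Zint w t - Zint w s) *\<^sub>R (mexp ((t - s) *\<^sub>R M) *v delta h u v s)"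
  by (simp add: integrand_def matrix_vector_mult_scaleR mexp_diff_mult exp_diff divide_inverse exp_minus)

lemma bounded_linear_scaled_mexp: "bounded_linear (\<lambda>y. c *\<^sub>R (mexp (t *\<^sub>R (M::real^'k^'k)) *v y))"
  by (rule bounded_linear_compose[OF bounded_linear_scaleR_right matrix_vector_mul_bounded_linear])

lemma has_integral_TU:
  assumes "continuous_on {..0} u" "continuous_on {..0} v" "t \<le> 0"
  shows "((\<lambda>s. exp (Zint w t - Zint w s) *\<^sub>R (mexp ((t - s) *\<^sub>R A) *v delta f u v s))
      has_integral (exp (Zint w t) *\<^sub>R (mexp (t *\<^sub>R A) *v u0) - TU u0 u v t)) {t..0}"
proof -
  let ?L = "\<lambda>y. exp (Zint w t) *\<^sub>R (mexp (t *\<^sub>R A) *v y)"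
  have "(?L \<circ> integrand A f u v has_integral ?L (integral {t..0} (integrand A f u v))) {t..0}"
    by (rule has_integral_linear[OF integrable_integral bounded_linear_scaled_mexp])
       (rule integrand_integrable_on_interval[OF f_lipschitz assms])
  moreover have "?L (integral {t..0} (integrand A f u v)) = ?L u0 - TU u0 u v t"
    by (simp add: TU_def matrix_vector_mult_diff_distrib scaleR_diff_right)
  ultimately show ?thesis by (simp add: comp_def integrand_scaled)
qed

lemma integrand_B_integrable_on_atMost:
  "in_Cminus \<eta> w u v \<Longrightarrow> t \<le> 0 \<Longrightarrow> integrand B g u v integrable_on {..t}"
  by (rule integrand_integrable_on_atMost[OF g_lipschitz _ _ eta(1)])
     (auto intro: B_dichotomy[of "- s" for s, simplified])

lemma has_integral_TV:
  assumes "in_Cminus \<eta> w u v" "t \<le> 0"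
  shows "((\<lambda>s. exp (Zint w t - Zint w s) *\<^sub>R (mexp ((t - s) *\<^sub>R B) *v delta g u v s))
      has_integral TV u v t) {..t}"
proof -
  let ?L = "\<lambda>y. exp (Zint w t) *\<^sub>R (mexp (t *\<^sub>R B) *v y)"
  have "(?L \<circ> integrand B g u v has_integral ?L (integral {..t} (integrand B g u v))) {..t}"
    by (rule has_integral_linear[OF integrable_integral bounded_linear_scaled_mexp])
       (rule integrand_B_integrable_on_atMost[OF assms])
  then show ?thesis by (simp add: comp_def integrand_scaled TV_def)
qed

lemma continuous_on_TU:
  assumes "continuous_on {..0} u" "continuous_on {..0} v"
  shows "continuous_on {..0} (TU u0 u v)"
  unfolding TU_def
  by (intro continuous_intros continuous_on_Zint continuous_on_integral_atLeastAtMost_atMost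
        integrand_integrable_on_interval[OF f_lipschitz assms])

lemma continuous_on_TV:
  assumes X: "in_Cminus \<eta> w u v"
  shows "continuous_on {..0} (TV u v)"
proof -
  let ?I = "integrand B g u v"
  have interval: "?I integrable_on {c..0}" if "c \<le> 0" for c
    using X that by (intro integrand_integrable_on_interval[OF g_lipschitz]) (auto simp: in_Cminus_iff)
  have split: "integral {..t} ?I = integral {..0} ?I - integral {t..0} ?I" if "t \<le> 0" for t
  proof -
    have "(?I has_integral (integral {..t} ?I + integral {t..0} ?I)) ({..t} \<union> {t..0})"
      by (rule has_integral_Un[OF integrable_integral integrable_integral negligible_subset[OF negligible_sing[of t]]])
         (auto intro: integrand_B_integrable_on_atMost[OF X that] interval[OF that])
    moreover have "{..t} \<union> {t..0} = {..0}" using that by auto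
    ultimately show ?thesis by (simp add: integral_unique)
  qed
  have "continuous_on {..0} (\<lambda>t. exp (Zint w t) *\<^sub>R (mexp (t *\<^sub>R B) *v (integral {..0} ?I - integral {t..0} ?I)))"
    by (intro continuous_intros continuous_on_Zint continuous_on_integral_atLeastAtMost_atMost interval)
  then show ?thesis
    \<comment> \<open>oriented right to left: from left to right the rule would loop at t = 0\<close>
    by (rule continuous_on_eq) (simp add: TV_def split[symmetric])
qed

lemma weighted_integral_estimate:
  fixes M :: "real^'k^'k" and h :: "real^'n \<Rightarrow> real^'m \<Rightarrow> real^'k"
  assumes h: "lipschitz2 K h" and S: "S \<subseteq> {..0}"
    and dichotomy: "\<And>s x. s \<in> S \<Longrightarrow> norm (mexp ((t - s) *\<^sub>R M) *v x) \<le> exp (c * (t - s)) * norm x"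
    and exp_integral: "((\<lambda>s. exp ((\<eta> - c) * s)) has_integral I) S"
    and D: "\<And>s. s \<le> 0 \<Longrightarrow> weight s * (norm (u s - u' s) + norm (v s - v' s)) \<le> D"
    and X: "((\<lambda>s. exp (Zint w t - Zint w s) *\<^sub>R (mexp ((t - s) *\<^sub>R M) *v delta h u v s)) has_integral X) S"
    and X': "((\<lambda>s. exp (Zint w t - Zint w s) *\<^sub>R (mexp ((t - s) *\<^sub>R M) *v delta h u' v' s)) has_integral X') S"
  shows "weight t * norm (X - X') \<le> K * D * exp ((c - \<eta>) * t) * I"
proof -
  let ?F = "\<lambda>s. exp (Zint w t - Zint w s) *\<^sub>R (mexp ((t - s) *\<^sub>R M) *v (delta h u v s - delta h u' v' s))"
  let ?c = "K * D * exp (Zint w t + c * t)"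
  have F: "(?F has_integral (X - X')) S"
    using has_integral_diff[OF X X'] by (simp add: matrix_vector_mult_diff_distrib scaleR_diff_right)
  have G: "((\<lambda>s. ?c * exp ((\<eta> - c) * s)) has_integral ?c * I) S"
    by (rule has_integral_mult_right[OF exp_integral])
  have "norm (?F s) \<le> ?c * exp ((\<eta> - c) * s)" if "s \<in> S" for s
  proof -
    have s: "s \<le> 0" using that S by auto
    have "norm (delta h u v s - delta h u' v' s) \<le> K * (D * exp (\<eta> * s + Zint w s))"
      by (rule order_trans[OF norm_delta_diff_le[OF h, of u v s u' v'] mult_left_mono[OF le_of_weight_mult_le[OF D[OF s]] K_nonneg]])
    then have "norm (?F s) \<le> exp (Zint w t - Zint w s) * (exp (c * (t - s)) * (K * (D * exp (\<eta> * s + Zint w s))))"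
      by (auto intro!: mult_left_mono order_trans[OF dichotomy[OF that]])
    also have "\<dots> = ?c * exp ((\<eta> - c) * s)"
      by (simp add: algebra_simps flip: exp_add)
    finally show ?thesis .
  qed
  from integral_norm_bound_integral[OF has_integral_integrable[OF F] has_integral_integrable[OF G] this]
  have "norm (X - X') \<le> ?c * I"
    by (simp add: integral_unique[OF F] integral_unique[OF G] integral_unique[OF exp_integral])
  then have "weight t * norm (X - X') \<le> weight t * (?c * I)"
    by (rule mult_left_mono) (simp add: less_imp_le[OF weight_pos])
  also have "weight t * (?c * I) = K * D * exp ((c - \<eta>) * t) * I"
    by (simp add: weight_def algebra_simps flip: exp_add)
  finally show ?thesis .
qed

lemma weighted_bound_nonneg:
  assumes "\<And>s. s \<le> 0 \<Longrightarrow> weight s * (norm (u s) + norm (v s)) \<le> D"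
  shows "0 \<le> D"
  using order_trans[OF _ assms[of 0]] weight_pos[of 0] by simp

lemma weight_mult_norm_TU_diff_le:
  assumes X: "in_Cminus \<eta> w u v" and X': "in_Cminus \<eta> w u' v'" and t: "t \<le> 0"
    and D: "\<And>s. s \<le> 0 \<Longrightarrow> weight s * (norm (u s - u' s) + norm (v s - v' s)) \<le> D"
  shows "weight t * norm (TU u0 u v t - TU u0 u' v' t) \<le> K / (a - \<eta>) * D"
proof -
  let ?P = "exp (Zint w t) *\<^sub>R (mexp (t *\<^sub>R A) *v u0)"
  have "0 \<le> D" using weighted_bound_nonneg[of "\<lambda>s. u s - u' s" "\<lambda>s. v s - v' s"] D by simp
  have "weight t * norm (TU u0 u v t - TU u0 u' v' t) = weight t * norm ((?P - TU u0 u v t) - (?P - TU u0 u' v' t))"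
    by (simp add: norm_minus_commute)
  also have "\<dots> \<le> K * D * exp ((a - \<eta>) * t) * ((1 - exp ((\<eta> - a) * t)) / (\<eta> - a))"
    using X X' t eta
    by (intro weighted_integral_estimate[OF f_lipschitz _ _ has_integral_exp_interval D, where M = A]
          has_integral_TU A_dichotomy) (auto simp: in_Cminus_iff)
  also have "\<dots> = K * D * (1 - exp ((a - \<eta>) * t)) / (a - \<eta>)"
  proof -
    have "exp ((a - \<eta>) * t) * exp ((\<eta> - a) * t) = 1" by (simp add: algebra_simps flip: exp_add)
    then show ?thesis using eta by (simp add: field_simps)
  qed
  also have "\<dots> \<le> K * D * 1 / (a - \<eta>)"
    using eta K_nonneg \<open>0 \<le> D\<close> by (intro divide_right_mono mult_left_mono) auto
  finally show ?thesis by simp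
qed

lemma weight_mult_norm_TV_diff_le:
  assumes X: "in_Cminus \<eta> w u v" and X': "in_Cminus \<eta> w u' v'" and t: "t \<le> 0"
    and D: "\<And>s. s \<le> 0 \<Longrightarrow> weight s * (norm (u s - u' s) + norm (v s - v' s)) \<le> D"
  shows "weight t * norm (TV u v t - TV u' v' t) \<le> K / (\<eta> - b) * D"
proof -
  have "weight t * norm (TV u v t - TV u' v' t) \<le> K * D * exp ((b - \<eta>) * t) * (exp ((\<eta> - b) * t) / (\<eta> - b))"
    using t eta
    by (intro weighted_integral_estimate[OF g_lipschitz _ _ has_integral_exp_atMost D, where M = B]
          has_integral_TV[OF X] has_integral_TV[OF X'] B_dichotomy) auto
  also have "\<dots> = K / (\<eta> - b) * D"
  proof -
    have "exp ((b - \<eta>) * t) * exp ((\<eta> - b) * t) = 1" by (simp add: algebra_simps flip: exp_add)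
    then show ?thesis by (simp add: field_simps)
  qed
  finally show ?thesis .
qed

definition rho :: real where "rho = K / (a - \<eta>) + K / (\<eta> - b)"

lemma rho_nonneg: "0 \<le> rho" and rho_less_1: "rho < 1"
  using eta K_nonneg contraction unfolding rho_def by auto

lemma T_contraction:
  assumes X: "in_Cminus \<eta> w u v" and X': "in_Cminus \<eta> w u' v'" and t: "t \<le> 0"
    and D: "\<And>s. s \<le> 0 \<Longrightarrow> weight s * (norm (u s - u' s) + norm (v s - v' s)) \<le> D"
  shows "weight t * (norm (TU u0 u v t - TU u0 u' v' t) + norm (TV u v t - TV u' v' t)) \<le> rho * D"
proof -
  have "weight t * norm (TU u0 u v t - TU u0 u' v' t) \<le> K / (a - \<eta>) * D"
    by (rule weight_mult_norm_TU_diff_le[OF assms])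
  moreover have "weight t * norm (TV u v t - TV u' v' t) \<le> K / (\<eta> - b) * D"
    by (rule weight_mult_norm_TV_diff_le[OF assms])
  ultimately show ?thesis by (simp add: rho_def distrib_left distrib_right)
qed

lemma in_Cminus_zero: "in_Cminus \<eta> w (\<lambda>_. 0) (\<lambda>_. 0)"
  unfolding in_Cminus_iff by (auto intro: bdd_aboveI2[where M = 0])

lemma integrand_zero: "integrand M h (\<lambda>_. 0) (\<lambda>_. 0) = (\<lambda>_. 0)"
  by (simp add: fun_eq_iff integrand_def delta_zero)

lemma TU_zero: "TU u0 (\<lambda>_. 0) (\<lambda>_. 0) t = exp (Zint w t) *\<^sub>R (mexp (t *\<^sub>R A) *v u0)"
  by (simp add: TU_def integrand_zero)

lemma TV_zero: "TV (\<lambda>_. 0) (\<lambda>_. 0) t = 0"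
  by (simp add: TV_def integrand_zero)

lemma in_Cminus_T:
  assumes X: "in_Cminus \<eta> w u v"
  shows "in_Cminus \<eta> w (TU u0 u v) (TV u v)"
proof -
  obtain C where C: "\<And>s. s \<le> 0 \<Longrightarrow> weight s * (norm (u s) + norm (v s)) \<le> C"
    using in_CminusE[OF X] by blast
  have "weight t * (norm (TU u0 u v t) + norm (TV u v t)) \<le> rho * C + norm u0" if t: "t \<le> 0" for t
  proof -
    have "weight t * norm (TU u0 (\<lambda>_. 0) (\<lambda>_. 0) t) = exp (- \<eta> * t) * norm (mexp (t *\<^sub>R A) *v u0)"
      by (simp add: TU_zero weight_def mult.assoc[symmetric] flip: exp_add)
    also have "\<dots> \<le> exp (- \<eta> * t) * (exp (a * t) * norm u0)"
      by (intro mult_left_mono A_dichotomy t) simp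
    also have "\<dots> = exp ((a - \<eta>) * t) * norm u0"
      by (simp add: algebra_simps flip: exp_add)
    also have "\<dots> \<le> norm u0"
      using eta t by (intro mult_left_le_one_le) (auto simp: mult_nonneg_nonpos)
    finally have "weight t * norm (TU u0 (\<lambda>_. 0) (\<lambda>_. 0) t) \<le> norm u0" .
    moreover have "weight t * (norm (TU u0 u v t - TU u0 (\<lambda>_. 0) (\<lambda>_. 0) t) +
        norm (TV u v t - TV (\<lambda>_. 0) (\<lambda>_. 0) t)) \<le> rho * C"
      using C by (intro T_contraction[OF X in_Cminus_zero t]) simp
    moreover have "weight t * norm (TU u0 u v t) \<le>
        weight t * norm (TU u0 u v t - TU u0 (\<lambda>_. 0) (\<lambda>_. 0) t) + weight t * norm (TU u0 (\<lambda>_. 0) (\<lambda>_. 0) t)"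
      using mult_left_mono[OF norm_triangle_sub less_imp_le[OF weight_pos]]
      by (simp add: distrib_left add.commute)
    ultimately show ?thesis by (simp add: TV_zero distrib_left)
  qed
  then show ?thesis
    using X unfolding in_Cminus_iff
    by (auto intro!: bdd_aboveI2 continuous_on_TU continuous_on_TV[OF X])
qed

lemma solves_iff_fixed_point:
  assumes X: "in_Cminus \<eta> w u v"
  shows "solves_lemma_system A B f g w xh yh u0 u v \<longleftrightarrow> (\<forall>t\<le>0. TU u0 u v t = u t \<and> TV u v t = v t)"
proof -
  have U: "((\<lambda>s. exp (Zint w t - Zint w s) *\<^sub>R (mexp ((t - s) *\<^sub>R A) *v delta f u v s))
      has_integral (exp (Zint w t) *\<^sub>R (mexp (t *\<^sub>R A) *v u0) - u t)) {t..0} \<longleftrightarrow> TU u0 u v t = u t"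
    (is "(?F has_integral (?P - u t)) _ \<longleftrightarrow> _") if "t \<le> 0" for t
  proof -
    have TU: "(?F has_integral (?P - TU u0 u v t)) {t..0}"
      using X that by (intro has_integral_TU) (auto simp: in_Cminus_iff)
    show ?thesis
    proof
      assume "(?F has_integral (?P - u t)) {t..0}"
      from has_integral_unique[OF TU this] show "TU u0 u v t = u t" by simp
    next
      assume "TU u0 u v t = u t"
      with TU show "(?F has_integral (?P - u t)) {t..0}" by simp
    qed
  qed
  have V: "((\<lambda>s. exp (Zint w t - Zint w s) *\<^sub>R (mexp ((t - s) *\<^sub>R B) *v delta g u v s))
      has_integral v t) {..t} \<longleftrightarrow> TV u v t = v t"
    (is "(?G has_integral v t) _ \<longleftrightarrow> _") if "t \<le> 0" for t
  proof
    assume "(?G has_integral v t) {..t}"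
    from has_integral_unique[OF has_integral_TV[OF X that] this] show "TV u v t = v t" .
  next
    assume "TV u v t = v t"
    with has_integral_TV[OF X that] show "(?G has_integral v t) {..t}" by simp
  qed
  have "solves_lemma_system A B f g w xh yh u0 u v \<longleftrightarrow>
      (\<forall>t\<le>0. ((\<lambda>s. exp (Zint w t - Zint w s) *\<^sub>R (mexp ((t - s) *\<^sub>R A) *v delta f u v s))
          has_integral (exp (Zint w t) *\<^sub>R (mexp (t *\<^sub>R A) *v u0) - u t)) {t..0} \<and>
        ((\<lambda>s. exp (Zint w t - Zint w s) *\<^sub>R (mexp ((t - s) *\<^sub>R B) *v delta g u v s))
          has_integral v t) {..t})"
    by (simp only: solves_lemma_system_def Let_def delta_def)
  also have "\<dots> \<longleftrightarrow> (\<forall>t\<le>0. TU u0 u v t = u t \<and> TV u v t = v t)"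
    using U V by blast
  finally show ?thesis .
qed

lemma weighted_geometric_limit:
  fixes F :: "nat \<Rightarrow> real \<Rightarrow> 'a::banach"
  assumes cont: "\<And>k. continuous_on {..0} (F k)"
    and step: "\<And>k s. s \<le> 0 \<Longrightarrow> weight s * norm (F (Suc k) s - F k s) \<le> C * rho ^ k"
    and "0 \<le> C"
  obtains l where "continuous_on {..0} l"
    "\<And>k s. s \<le> 0 \<Longrightarrow> weight s * norm (l s - F k s) \<le> C * rho ^ k / (1 - rho)"
proof -
  have weighted_dist: "dist (weight s *\<^sub>R x) (weight s *\<^sub>R y) = weight s * norm (x - y)" for s and x y :: 'a
    using weight_pos[of s] by (simp add: dist_norm flip: scaleR_diff_right)
  have weighted_cont: "continuous_on {..0} (\<lambda>s. weight s *\<^sub>R F k s)" for k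
    by (intro continuous_on_scaleR continuous_on_weight cont)
  have weighted_step: "dist (weight s *\<^sub>R F (Suc k) s) (weight s *\<^sub>R F k s) \<le> C * rho ^ k"
    if "s \<in> {..0}" for k s
    using that by (simp add: weighted_dist step)
  obtain G where G: "continuous_on {..0} G"
    "\<And>k s. s \<in> {..0} \<Longrightarrow> dist (G s) (weight s *\<^sub>R F k s) \<le> C * rho ^ k / (1 - rho)"
    by (rule geometric_uniform_limit[OF weighted_cont weighted_step rho_nonneg rho_less_1 \<open>0 \<le> C\<close>]) (auto intro: that)
  define l where "l s = inverse (weight s) *\<^sub>R G s" for s
  have G_eq: "G s = weight s *\<^sub>R l s" for s
    using weight_pos[of s] by (simp add: l_def)
  have "continuous_on {..0} l"
    unfolding l_def using weight_pos
    by (intro continuous_on_scaleR continuous_on_inverse continuous_on_weight G(1)) (metis less_irrefl)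
  moreover have "weight s * norm (l s - F k s) \<le> C * rho ^ k / (1 - rho)" if "s \<le> 0" for k s
    using G(2)[of s k] that by (simp add: G_eq weighted_dist)
  ultimately show ?thesis by (rule that)
qed

definition picard :: "real^'n \<Rightarrow> nat \<Rightarrow> (real \<Rightarrow> real^'n) \<times> (real \<Rightarrow> real^'m)"
  where "picard u0 k = ((\<lambda>(u, v). (TU u0 u v, TV u v)) ^^ k) (\<lambda>_. 0, \<lambda>_. 0)"

lemma picard_0: "picard u0 0 = (\<lambda>_. 0, \<lambda>_. 0)"
  by (simp add: picard_def)

lemma picard_Suc:
  "picard u0 (Suc k) = (TU u0 (fst (picard u0 k)) (snd (picard u0 k)), TV (fst (picard u0 k)) (snd (picard u0 k)))"
  by (simp add: picard_def case_prod_beta)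

lemma in_Cminus_picard: "in_Cminus \<eta> w (fst (picard u0 k)) (snd (picard u0 k))"
  by (induction k) (simp_all add: picard_0 picard_Suc in_Cminus_zero in_Cminus_T)

lemma picard_geometric:
  obtains C where "0 \<le> C" "\<And>k s. s \<le> 0 \<Longrightarrow>
    weight s * (norm (fst (picard u0 (Suc k)) s - fst (picard u0 k) s) +
                norm (snd (picard u0 (Suc k)) s - snd (picard u0 k) s)) \<le> C * rho ^ k"
proof -
  obtain C where C: "\<And>s. s \<le> 0 \<Longrightarrow>
      weight s * (norm (fst (picard u0 (Suc 0)) s) + norm (snd (picard u0 (Suc 0)) s)) \<le> C"
    using in_CminusE[OF in_Cminus_picard] by blast
  have "weight s * (norm (fst (picard u0 (Suc k)) s - fst (picard u0 k) s) +
      norm (snd (picard u0 (Suc k)) s - snd (picard u0 k) s)) \<le> C * rho ^ k" if "s \<le> 0" for k s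
    using that
  proof (induction k arbitrary: s)
    case 0
    then show ?case using C by (simp add: picard_0)
  next
    case (Suc k)
    show ?case
      using T_contraction[OF in_Cminus_picard in_Cminus_picard Suc.prems Suc.IH]
      by (simp add: picard_Suc[of u0 "Suc k"] picard_Suc[of u0 k] mult_ac)
  qed
  moreover have "0 \<le> C" using C by (rule weighted_bound_nonneg)
  ultimately show ?thesis using that by blast
qed

lemma eq_if_weighted_le_0:
  fixes x x' :: "'a::real_normed_vector" and y y' :: "'b::real_normed_vector"
  assumes "weight t * (norm (x - x') + norm (y - y')) \<le> 0"
  shows "x = x' \<and> y = y'"
proof -
  have "norm (x - x') + norm (y - y') \<le> 0"
    using assms weight_pos[of t] by (simp add: mult_le_0_iff)
  then have "norm (x - x') = 0" "norm (y - y') = 0"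
    using norm_ge_zero[of "x - x'"] norm_ge_zero[of "y - y'"] by linarith+
  then show ?thesis by simp
qed

lemma picard_converges:
  obtains u v C where "in_Cminus \<eta> w u v"
    "\<And>k s. s \<le> 0 \<Longrightarrow>
      weight s * (norm (u s - fst (picard u0 k) s) + norm (v s - snd (picard u0 k) s)) \<le> C * rho ^ k"
proof -
  let ?u = "\<lambda>k. fst (picard u0 k)" and ?v = "\<lambda>k. snd (picard u0 k)"
  obtain C where "0 \<le> C" and step: "\<And>k s. s \<le> 0 \<Longrightarrow>
      weight s * (norm (?u (Suc k) s - ?u k s) + norm (?v (Suc k) s - ?v k s)) \<le> C * rho ^ k"
    using picard_geometric by blast
  have u_step: "weight s * norm (?u (Suc k) s - ?u k s) \<le> C * rho ^ k"
    and v_step: "weight s * norm (?v (Suc k) s - ?v k s) \<le> C * rho ^ k" if "s \<le> 0" for k s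
    using step[OF that, of k] weight_mult_norm_nonneg[of s "?u (Suc k) s - ?u k s"]
      weight_mult_norm_nonneg[of s "?v (Suc k) s - ?v k s"]
    by (simp_all add: distrib_left)
  have u_cont: "continuous_on {..0} (?u k)" and v_cont: "continuous_on {..0} (?v k)" for k
    using in_Cminus_picard[of u0 k] by (simp_all add: in_Cminus_iff)
  obtain u where u: "continuous_on {..0} u"
      "\<And>k s. s \<le> 0 \<Longrightarrow> weight s * norm (u s - ?u k s) \<le> C * rho ^ k / (1 - rho)"
    by (rule weighted_geometric_limit[OF u_cont u_step \<open>0 \<le> C\<close>]) (auto intro: that)
  obtain v where v: "continuous_on {..0} v"
      "\<And>k s. s \<le> 0 \<Longrightarrow> weight s * norm (v s - ?v k s) \<le> C * rho ^ k / (1 - rho)"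
    by (rule weighted_geometric_limit[OF v_cont v_step \<open>0 \<le> C\<close>]) (auto intro: that)
  have close: "weight s * (norm (u s - ?u k s) + norm (v s - ?v k s)) \<le> (2 * C / (1 - rho)) * rho ^ k"
    if "s \<le> 0" for k s
    using u(2)[OF that, of k] v(2)[OF that, of k] by (simp add: distrib_left)
  moreover have "in_Cminus \<eta> w u v"
    unfolding in_Cminus_iff using close[of _ 0] u(1) v(1)
    by (auto simp: picard_0 intro!: bdd_aboveI2[where M = "2 * C / (1 - rho)"])
  ultimately show ?thesis using that by blast
qed

lemma fixed_point_exists:
  "\<exists>u v. in_Cminus \<eta> w u v \<and> (\<forall>t\<le>0. TU u0 u v t = u t \<and> TV u v t = v t)"
proof -
  let ?u = "\<lambda>k. fst (picard u0 k)" and ?v = "\<lambda>k. snd (picard u0 k)"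
  obtain u v C where X: "in_Cminus \<eta> w u v" and close: "\<And>k s. s \<le> 0 \<Longrightarrow>
      weight s * (norm (u s - ?u k s) + norm (v s - ?v k s)) \<le> C * rho ^ k"
    using picard_converges by blast
  have "TU u0 u v s = u s \<and> TV u v s = v s" if s: "s \<le> 0" for s
  proof (rule eq_if_weighted_le_0, rule le_zero_if_le_geometric[OF _ rho_nonneg rho_less_1])
    fix k
    have "weight s * (norm (TU u0 u v s - u s) + norm (TV u v s - v s)) \<le>
        weight s * (norm (TU u0 u v s - ?u (Suc k) s) + norm (TV u v s - ?v (Suc k) s)) +
        weight s * (norm (u s - ?u (Suc k) s) + norm (v s - ?v (Suc k) s))"
      unfolding distrib_left[symmetric]
      by (intro mult_left_mono less_imp_le[OF weight_pos])
         (use dist_triangle2[of "TU u0 u v s" "u s" "?u (Suc k) s"]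
              dist_triangle2[of "TV u v s" "v s" "?v (Suc k) s"] in \<open>simp add: dist_norm\<close>)
    also have "\<dots> \<le> rho * (C * rho ^ k) + C * rho ^ Suc k"
    proof -
      have contraction: "weight s * (norm (TU u0 u v s - TU u0 (?u k) (?v k) s) +
          norm (TV u v s - TV (?u k) (?v k) s)) \<le> rho * (C * rho ^ k)"
        by (rule T_contraction[OF X in_Cminus_picard s close])
      have "?u (Suc k) = TU u0 (?u k) (?v k)" "?v (Suc k) = TV (?u k) (?v k)"
        by (simp_all add: picard_Suc)
      then show ?thesis using add_mono[OF contraction close[OF s, of "Suc k"]] by simp
    qed
    also have "\<dots> = (2 * C * rho) * rho ^ k"
      by (simp add: algebra_simps)
    finally show "weight s * (norm (TU u0 u v s - u s) + norm (TV u v s - v s)) \<le> (2 * C * rho) * rho ^ k" .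
  qed
  with X show ?thesis by blast
qed

lemma fixed_point_unique:
  assumes X: "in_Cminus \<eta> w u v" and fixed: "\<And>t. t \<le> 0 \<Longrightarrow> TU u0 u v t = u t \<and> TV u v t = v t"
    and X': "in_Cminus \<eta> w u' v'" and fixed': "\<And>t. t \<le> 0 \<Longrightarrow> TU u0 u' v' t = u' t \<and> TV u' v' t = v' t"
    and t: "t \<le> 0"
  shows "u t = u' t \<and> v t = v' t"
proof -
  obtain C where C: "\<And>s. s \<le> 0 \<Longrightarrow> weight s * (norm (u s) + norm (v s)) \<le> C"
    using in_CminusE[OF X] by blast
  obtain C' where C': "\<And>s. s \<le> 0 \<Longrightarrow> weight s * (norm (u' s) + norm (v' s)) \<le> C'"
    using in_CminusE[OF X'] by blast
  have "weight s * (norm (u s - u' s) + norm (v s - v' s)) \<le> (C + C') * rho ^ k" if "s \<le> 0" for k s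
    using that
  proof (induction k arbitrary: s)
    case 0
    have "weight s * (norm (u s - u' s) + norm (v s - v' s)) \<le>
        weight s * (norm (u s) + norm (v s)) + weight s * (norm (u' s) + norm (v' s))"
      unfolding distrib_left[symmetric]
      using norm_triangle_ineq4[of "u s" "u' s"] norm_triangle_ineq4[of "v s" "v' s"]
      by (intro mult_left_mono less_imp_le[OF weight_pos]) linarith
    with C[OF 0] C'[OF 0] show ?case by simp
  next
    case (Suc k)
    have "weight s * (norm (TU u0 u v s - TU u0 u' v' s) + norm (TV u v s - TV u' v' s)) \<le> rho * ((C + C') * rho ^ k)"
      by (rule T_contraction[OF X X' Suc.prems Suc.IH])
    then show ?case
      using fixed[OF Suc.prems] fixed'[OF Suc.prems] by (simp add: mult_ac)
  qed
  then have "weight t * (norm (u t - u' t) + norm (v t - v' t)) \<le> 0"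
    by (rule le_zero_if_le_geometric[OF _ rho_nonneg rho_less_1]) (rule t)
  then show ?thesis by (rule eq_if_weighted_le_0)
qed

end

theorem lemma4p2:
  fixes A :: "real^'n^'n" and B :: "real^'m^'m"
    and f :: "real^'n \<Rightarrow> real^'m \<Rightarrow> real^'n" and g :: "real^'n \<Rightarrow> real^'m \<Rightarrow> real^'m"
    and a b K \<eta> :: real and w :: "real \<Rightarrow> real"
    and xh0 :: "real^'n" and yh0 :: "real^'m"
    and xh :: "real \<Rightarrow> real^'n" and yh :: "real \<Rightarrow> real^'m"
  assumes ba: "b < 0" "0 < a"
    and A_dich: "\<And>t x. t \<le> 0 \<Longrightarrow> norm (mexp (t *\<^sub>R A) *v x) \<le> exp (a * t) * norm x"
    and B_dich: "\<And>t y. t \<ge> 0 \<Longrightarrow> norm (mexp (t *\<^sub>R B) *v y) \<le> exp (b * t) * norm y"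
    and f0: "f 0 0 = 0" and g0: "g 0 0 = 0"
    and f_lip: "\<And>x1 y1 x2 y2. norm (f x1 y1 - f x2 y2) \<le> K * (norm (x1 - x2) + norm (y1 - y2))"
    and g_lip: "\<And>x1 y1 x2 y2. norm (g x1 y1 - g x2 y2) \<le> K * (norm (x1 - x2) + norm (y1 - y2))"
    and Omega: "in_Omega w"
    and orbit: "rde_solution A B f g w xh yh" "xh 0 = xh0" "yh 0 = yh0"
    and eta: "\<eta> > 0" "b < \<eta>" "\<eta> < a"
    and rho: "K / (a - \<eta>) + K / (\<eta> - b) < 1"
  shows "\<forall>u0. (\<exists>u v. in_Cminus \<eta> w u v \<and> solves_lemma_system A B f g w xh yh u0 u v) \<and>
           (\<forall>u v u' v'. in_Cminus \<eta> w u v \<and> solves_lemma_system A B f g w xh yh u0 u v \<and>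
                        in_Cminus \<eta> w u' v' \<and> solves_lemma_system A B f g w xh yh u0 u' v'
                        \<longrightarrow> (\<forall>t\<le>0. u t = u' t \<and> v t = v' t))"
proof -
  have f: "lipschitz2 K f" and g: "lipschitz2 K g"
    using f_lip g_lip by (simp_all add: lipschitz2_def)
  interpret integral_system A B f g a b K \<eta> w xh yh
    by (rule integral_system.intro)
       (use A_dich B_dich f g lipschitz2_nonneg[OF f] Omega orbit(1) eta rho in
         \<open>auto simp: in_Omega_def rde_solution_def\<close>)
  show ?thesis
  proof (intro allI conjI impI)
    fix u0
    show "\<exists>u v. in_Cminus \<eta> w u v \<and> solves_lemma_system A B f g w xh yh u0 u v"
      using fixed_point_exists[of u0] solves_iff_fixed_point by blast
  next
    fix u0 u v u' v' and t :: real
    assume "in_Cminus \<eta> w u v \<and> solves_lemma_system A B f g w xh yh u0 u v \<and>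
      in_Cminus \<eta> w u' v' \<and> solves_lemma_system A B f g w xh yh u0 u' v'" and "t \<le> 0"
    then show "u t = u' t" and "v t = v' t"
      using fixed_point_unique[of u v u0 u' v' t] solves_iff_fixed_point by blast+
  qed
qed

end
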